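(* Suppose $P_{n,K}$ is full-dimensional, and let $v\in\{4,5,\dots,n\}$. The inequality $x_v\ge 0$ is facet-defining for $P_{n,K}$ if and only if $K\ne n-2$.
   Context: $V=\{1,\dots,n\}$ and $E$ is the set of all unordered pairs $ij$ of distinct elements of $V$; $x_{i,j}=x_{j,i}$. A $K$-partition $\pi$ is a collection of $K$ non-empty pairwise disjoint subsets (clusters) of $V$ whose union is $V$. The representative of a cluster is its smallest element. The characteristic vector $x^\pi\in\{0,1\}^{|E|+|V|-3}$ of $\pi$ has components $x_4,\dots,x_n$ and $x_{i,j}$ for $ij\in E$, where $x^\pi_{i,j}=1$ if $i,j$ are in the same cluster and $0$ otherwise, and $x^\pi_u=1$ if $u$ is the representative of its cluster and $0$ otherwise. (Representative variables of vertices $1,2,3$ are not coordinates.) $P_{n,K}\subset\mathbb R^{|E|+|V|-3}$ is the convex hull of the characteristic vectors $x^\pi$ of all $K$-partitions $\pi$ of $V$ (equivalently, of all $0/1$ solutions of the integer formulation of the $K$-partitioning problem). It is full-dimensional (dimension $|E|+|V|-3$) if and only if $K\in\{3,\dots,n-2\}$. An inequality is facet-defining for $P_{n,K}$ if it is valid for $P_{n,K}$ and the set of points of $P_{n,K}$ satisfying it with equality has dimension $\dim(P_{n,K})-1$. *)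

theory Defs
  imports "HOL-Analysis.Analysis" "HOL-Library.Disjoint_Sets"
begin

definition edges :: "nat \<Rightarrow> nat set set" where
  "edges n = {{i, j} | i j. i \<in> {1..n} \<and> j \<in> {1..n} \<and> i \<noteq> j}"

definition is_K_partition :: "nat \<Rightarrow> nat \<Rightarrow> nat set set \<Rightarrow> bool" where
  "is_K_partition n K \<pi> \<longleftrightarrow> partition_on {1..n} \<pi> \<and> card \<pi> = K"

datatype coord = Rep nat | Edge "nat set"

text \<open>The coordinates of the ambient space: there is no representative variable for the
  vertices 1, 2, 3.\<close>

definition coords :: "nat \<Rightarrow> coord set" where
  "coords n = Rep ` {4..n} \<union> Edge ` edges n"

fun char_entry :: "nat set set \<Rightarrow> coord \<Rightarrow> real" where
  "char_entry \<pi> (Rep u) = of_bool (\<exists>C\<in>\<pi>. u \<in> C \<and> u = Min C)"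
| "char_entry \<pi> (Edge e) = of_bool (\<exists>C\<in>\<pi>. e \<subseteq> C)"

text \<open>The space with one real coordinate for each element of \<^term>\<open>coords n\<close> is rendered as
  \<^typ>\<open>real ^ 'd\<close>, where the finite index type \<^typ>\<open>'d\<close> comes with a labelling
  \<open>\<phi>\<close> such that \<^prop>\<open>bij_betw \<phi> UNIV (coords n)\<close>. The coordinate \<open>x\<^sub>v\<close> of a point \<open>x\<close> is then
  \<open>x $ inv \<phi> (Rep v)\<close>.\<close>

definition char_vec :: "('d::finite \<Rightarrow> coord) \<Rightarrow> nat set set \<Rightarrow> real ^ 'd" where
  "char_vec \<phi> \<pi> = (\<chi> d. char_entry \<pi> (\<phi> d))"

definition partition_polytope ::
    "('d::finite \<Rightarrow> coord) \<Rightarrow> nat \<Rightarrow> nat \<Rightarrow> (real ^ 'd) set" where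
  "partition_polytope \<phi> n K = convex hull (char_vec \<phi> ` {\<pi>. is_K_partition n K \<pi>})"

definition full_dimensional :: "'a::euclidean_space set \<Rightarrow> bool" where
  "full_dimensional P \<longleftrightarrow> aff_dim P = int DIM('a)"

text \<open>The linear inequality \<open>f x \<ge> b\<close> is facet-defining for \<open>P\<close>.\<close>

definition facet_defining :: "'a::euclidean_space set \<Rightarrow> ('a \<Rightarrow> real) \<Rightarrow> real \<Rightarrow> bool" where
  "facet_defining P f b \<longleftrightarrow>
     linear f \<and> (\<forall>x\<in>P. f x \<ge> b) \<and> aff_dim {x \<in> P. f x = b} = aff_dim P - 1"

end

theory Submission
  imports Defs
begin

text \<open>Let \<open>v\<close> be a vertex and consider partitions in which \<open>v\<close> does not represent its cluster. If
  \<open>K = n - 2\<close>, exactly one vertex besides \<open>v\<close> is not a representative, so exactly one edge avoiding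
  \<open>v\<close> lies inside a cluster. Hence the face \<open>x\<^sub>v = 0\<close> lies in the hyperplane on which these edge
  variables sum to 1; the latter misses the origin, so the face is too small to be a facet. If
  \<open>3 \<le> K \<le> n - 3\<close>, take any linear equation satisfied by the face. It is additive over clusters,
  so repartitioning two clusters, at most five vertices in all, into two others yields relations
  between few coefficients. Moving \<open>v\<close> kills the coefficients of its edges, moving another vertex
  \<open>k \<ge> 4\<close> kills those of the edges at \<open>k\<close>, and the vertices 1, 2, 3 kill the rest, so that the
  equation is a multiple of \<open>x\<^sub>v = 0\<close>. The other values of \<open>K\<close> satisfy an explicit equation and are
  excluded by full-dimensionality.\<close>

section \<open>Edges and linear functionals on characteristic vectors\<close>

lemma finite_edges [simp]: "finite (edges n)"
proof (rule finite_subset)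
  show "edges n \<subseteq> Pow {1..n}"
    by (auto simp: edges_def)
qed auto

lemma doubleton_in_edges_iff: "{i, j} \<in> edges n \<longleftrightarrow> i \<in> {1..n} \<and> j \<in> {1..n} \<and> i \<noteq> j"
  by (auto simp: edges_def doubleton_eq_iff)

text \<open>The inner product of a coefficient vector with a characteristic vector, written without
  the labelling \<open>\<phi>\<close>, so that the combinatorial arguments can avoid the index
  type.\<close>

definition functional :: "(coord \<Rightarrow> real) \<Rightarrow> nat \<Rightarrow> nat set set \<Rightarrow> real" where
  "functional w n \<pi> =
     (\<Sum>u\<in>{4..n}. w (Rep u) * char_entry \<pi> (Rep u)) +
     (\<Sum>e\<in>edges n. w (Edge e) * char_entry \<pi> (Edge e))"

lemma inner_char_vec:
  fixes \<phi> :: "'d::finite \<Rightarrow> coord"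
  assumes "bij_betw \<phi> UNIV (coords n)"
  shows "(\<chi> d. w (\<phi> d)) \<bullet> char_vec \<phi> \<pi> = functional w n \<pi>"
proof -
  have "(\<chi> d. w (\<phi> d)) \<bullet> char_vec \<phi> \<pi> = (\<Sum>d\<in>UNIV. w (\<phi> d) * char_entry \<pi> (\<phi> d))"
    by (simp add: inner_vec_def char_vec_def)
  also have "\<dots> = (\<Sum>c\<in>coords n. w c * char_entry \<pi> c)"
    by (rule sum.reindex_bij_betw [OF assms])
  also have "\<dots> = (\<Sum>c\<in>Rep ` {4..n}. w c * char_entry \<pi> c) + (\<Sum>c\<in>Edge ` edges n. w c * char_entry \<pi> c)"
    unfolding coords_def by (rule sum.union_disjoint) auto
  also have "\<dots> = functional w n \<pi>"
    by (simp add: functional_def sum.reindex inj_on_def)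
  finally show ?thesis .
qed

text \<open>The equation passes from the vertices to the convex hull and on to the affine hull. The
  nonzero coefficient at \<open>c\<close> makes the normal vector nonzero, so that this affine hull
  is a proper subset of the space.\<close>

lemma not_full_dimensional_if_functional_const:
  fixes \<phi> :: "'d::finite \<Rightarrow> coord"
  assumes \<phi>: "bij_betw \<phi> UNIV (coords n)"
    and c: "c \<in> coords n" "w c \<noteq> 0"
    and const: "\<And>\<pi>. is_K_partition n K \<pi> \<Longrightarrow> functional w n \<pi> = b"
  shows "\<not> full_dimensional (partition_polytope \<phi> n K)"
proof -
  define a where "a = (\<chi> d. w (\<phi> d))"
  obtain d where "\<phi> d = c"
    using \<phi> c(1) by (metis bij_betw_imp_surj_on imageE)
  then have "a $ d \<noteq> 0"
    using c(2) by (simp add: a_def)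
  then have "a \<noteq> 0"
    by auto
  have "partition_polytope \<phi> n K \<subseteq> {x. a \<bullet> x = b}"
    unfolding partition_polytope_def
  proof (rule hull_minimal)
    show "char_vec \<phi> ` {\<pi>. is_K_partition n K \<pi>} \<subseteq> {x. a \<bullet> x = b}"
      using const by (auto simp: a_def inner_char_vec [OF \<phi>])
    show "convex {x. a \<bullet> x = b}"
      by (rule convex_hyperplane)
  qed
  then have "affine hull partition_polytope \<phi> n K \<subseteq> {x. a \<bullet> x = b}"
    by (intro hull_minimal affine_hyperplane)
  moreover have "{x. a \<bullet> x = b} \<noteq> UNIV"
    using \<open>a \<noteq> 0\<close> by (simp add: hyperplane_eq_UNIV)
  ultimately show ?thesis
    unfolding full_dimensional_def aff_dim_eq_full by blast
qed

section \<open>Representatives as cluster minima\<close>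

lemma partition_on_Min_in:
  assumes "partition_on {1..n::nat} \<pi>" "C \<in> \<pi>"
  shows "finite C" "C \<noteq> {}" "C \<subseteq> {1..n}" "Min C \<in> C" "Min C \<in> {1..n}"
proof -
  show *: "C \<subseteq> {1..n}"
    using assms by (auto simp: partition_on_def)
  then show "finite C"
    by (rule finite_subset) simp
  moreover show "C \<noteq> {}"
    using assms by (auto simp: partition_on_def)
  ultimately show "Min C \<in> C"
    by (rule Min_in)
  with * show "Min C \<in> {1..n}" by blast
qed

lemma partition_on_inj_Min:
  assumes "partition_on {1..n::nat} \<pi>"
  shows "inj_on Min \<pi>"
proof (rule inj_onI)
  fix C D assume "C \<in> \<pi>" "D \<in> \<pi>" "Min C = Min D"
  then have "Min C \<in> C \<inter> D"
    using partition_on_Min_in(4) [OF assms] by (metis IntI)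
  then show "C = D"
    using assms \<open>C \<in> \<pi>\<close> \<open>D \<in> \<pi>\<close> by (auto simp: partition_on_def disjoint_def)
qed

lemma rep_of_own_cluster:
  fixes n :: nat
  assumes \<pi>: "partition_on {1..n} \<pi>" and k: "k \<in> Min ` \<pi>" "k \<in> C" "C \<in> \<pi>"
  shows "k = Min C"
proof -
  obtain D where D: "D \<in> \<pi>" "k = Min D"
    using k(1) by blast
  then have "k \<in> D"
    using partition_on_Min_in(4) [OF \<pi>] by blast
  with k(2,3) D(1) \<pi> have "C = D"
    unfolding partition_on_def disjoint_def by blast
  with D(2) show ?thesis by simp
qed

lemma smaller_rep_if_nonrep:
  fixes n :: nat
  assumes \<pi>: "partition_on {1..n} \<pi>" and i: "i \<in> {1..n}" "i \<notin> Min ` \<pi>"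
  obtains k where "k \<in> Min ` \<pi>" "k < i" "\<exists>C\<in>\<pi>. {k, i} \<subseteq> C"
proof -
  have "i \<in> \<Union> \<pi>"
    using i(1) \<pi> by (auto simp: partition_on_def)
  then obtain C where C: "C \<in> \<pi>" "i \<in> C" by blast
  note MinC = partition_on_Min_in [OF \<pi> C(1)]
  have "Min C \<le> i" "Min C \<noteq> i"
    using MinC(1) C i(2) by auto
  with C MinC(4) that [of "Min C"] show ?thesis by auto
qed

lemma char_entry_Rep_iff:
  assumes "partition_on {1..n} \<pi>"
  shows "char_entry \<pi> (Rep u) = of_bool (u \<in> Min ` \<pi>)"
  using partition_on_Min_in(4) [OF assms] by (auto simp: image_iff)

lemma card_Min_image:
  assumes "is_K_partition n K \<pi>"
  shows "card (Min ` \<pi>) = K" "Min ` \<pi> \<subseteq> {1..n}" "finite \<pi>"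
proof -
  have \<pi>: "partition_on {1..n} \<pi>" "card \<pi> = K"
    using assms by (auto simp: is_K_partition_def)
  show "card (Min ` \<pi>) = K"
    using partition_on_inj_Min [OF \<pi>(1)] \<pi>(2) by (simp add: card_image)
  show "Min ` \<pi> \<subseteq> {1..n}"
    using partition_on_Min_in(5) [OF \<pi>(1)] by blast
  show "finite \<pi>"
    using \<pi>(1) by (rule finite_elements [rotated]) simp
qed

section \<open>Additivity of linear functionals over clusters\<close>

text \<open>The share of a single cluster in \<open>functional\<close>. The case distinction
  reflects that the vertices 1, 2, 3 have no representative coordinate.\<close>

definition cluster_weight :: "(coord \<Rightarrow> real) \<Rightarrow> nat \<Rightarrow> nat set \<Rightarrow> real" where
  "cluster_weight w n C =
     (if 4 \<le> Min C then w (Rep (Min C)) else 0) + (\<Sum>e | e \<in> edges n \<and> e \<subseteq> C. w (Edge e))"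

text \<open>Distinct clusters have distinct minima and, being disjoint, cannot contain the same
  edge. Hence each entry of the characteristic vector is a sum of indicators over the clusters, and
  the order of summation can be exchanged.\<close>

lemma functional_eq_sum_cluster_weight:
  assumes \<pi>: "partition_on {1..n} \<pi>"
  shows "functional w n \<pi> = (\<Sum>C\<in>\<pi>. cluster_weight w n C)"
proof -
  have fin: "finite \<pi>"
    using \<pi> by (rule finite_elements [rotated]) simp
  have of_bool_Bex: "of_bool (\<exists>C\<in>\<pi>. P C) = (\<Sum>C\<in>\<pi>. of_bool (P C) :: real)"
    if "\<And>C D. C \<in> \<pi> \<Longrightarrow> D \<in> \<pi> \<Longrightarrow> P C \<Longrightarrow> P D \<Longrightarrow> C = D" for P
  proof (cases "\<exists>C\<in>\<pi>. P C")
    case True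
    then obtain C where C: "C \<in> \<pi>" "P C" by blast
    have "(\<Sum>D\<in>\<pi>. of_bool (P D) :: real) = (\<Sum>D\<in>\<pi>. if D = C then 1 else 0)"
      using that C by (intro sum.cong) auto
    then show ?thesis
      using C fin by auto
  qed auto
  have Rep: "char_entry \<pi> (Rep u) = (\<Sum>C\<in>\<pi>. of_bool (u = Min C))" for u
    unfolding char_entry_Rep_iff [OF \<pi>] image_iff
    by (rule of_bool_Bex) (use partition_on_inj_Min [OF \<pi>] in \<open>auto simp: inj_on_def\<close>)
  have Edge: "char_entry \<pi> (Edge e) = (\<Sum>C\<in>\<pi>. of_bool (e \<subseteq> C))" if e: "e \<in> edges n" for e
  proof -
    obtain i where "i \<in> e"
      using e by (auto simp: edges_def)
    then show ?thesis
      unfolding char_entry.simps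
      by (intro of_bool_Bex) (use \<pi> in \<open>unfold partition_on_def disjoint_def, blast\<close>)
  qed
  have "functional w n \<pi> =
      (\<Sum>u\<in>{4..n}. \<Sum>C\<in>\<pi>. w (Rep u) * of_bool (u = Min C)) +
      (\<Sum>e\<in>edges n. \<Sum>C\<in>\<pi>. w (Edge e) * of_bool (e \<subseteq> C))"
    unfolding functional_def by (simp only: Rep Edge sum_distrib_left cong: sum.cong)
  also have "\<dots> =
      (\<Sum>C\<in>\<pi>. (\<Sum>u\<in>{4..n}. w (Rep u) * of_bool (u = Min C)) +
        (\<Sum>e\<in>edges n. w (Edge e) * of_bool (e \<subseteq> C)))"
    by (subst (1 2) sum.swap) (simp add: sum.distrib)
  also have "\<dots> = (\<Sum>C\<in>\<pi>. cluster_weight w n C)"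
  proof (rule sum.cong [OF refl])
    fix C assume "C \<in> \<pi>"
    then have "Min C \<le> n"
      using partition_on_Min_in(5) [OF \<pi>] by auto
    have "(\<Sum>u\<in>{4..n}. w (Rep u) * of_bool (u = Min C)) =
        (\<Sum>u\<in>{4..n}. if u = Min C then w (Rep u) else 0)"
      by (intro sum.cong) auto
    also have "\<dots> = (if 4 \<le> Min C then w (Rep (Min C)) else 0)"
      using \<open>Min C \<le> n\<close> by simp
    finally show "(\<Sum>u\<in>{4..n}. w (Rep u) * of_bool (u = Min C)) +
        (\<Sum>e\<in>edges n. w (Edge e) * of_bool (e \<subseteq> C)) = cluster_weight w n C"
      by (simp add: cluster_weight_def of_bool_def if_distrib sum.inter_filter cong: if_cong
          del: sum.delta)
  qed
  finally show ?thesis .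
qed

text \<open>The element \<open>a\<close> below \<open>k\<close> keeps the representative unchanged,
  so only the edges joining \<open>k\<close> to \<open>C\<close> are new.\<close>

lemma cluster_weight_insert:
  assumes C: "C \<subseteq> {1..n}" "a \<in> C" "a < k" and k: "k \<in> {1..n}" "k \<notin> C"
  shows "cluster_weight w n (insert k C) = cluster_weight w n C + (\<Sum>c\<in>C. w (Edge {c, k}))"
proof -
  have fin: "finite C"
    using C(1) by (rule finite_subset) simp
  have "Min C \<le> a"
    using fin C(2) by simp
  with C(3) have "Min C < k" by simp
  then have Min: "Min (insert k C) = Min C"
    using fin C(2,3) by (subst Min_insert) auto
  have "{e \<in> edges n. e \<subseteq> insert k C} = {e \<in> edges n. e \<subseteq> C} \<union> (\<lambda>c. {c, k}) ` C"
  proof (intro equalityI subsetI)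
    fix e assume "e \<in> {e \<in> edges n. e \<subseteq> insert k C}"
    then obtain i j where "e = {i, j}" "i \<noteq> j" "e \<in> edges n" "e \<subseteq> insert k C"
      by (auto simp: edges_def)
    then show "e \<in> {e \<in> edges n. e \<subseteq> C} \<union> (\<lambda>c. {c, k}) ` C"
      by (cases "i = k"; cases "j = k") (auto simp: insert_commute)
  next
    fix e assume "e \<in> {e \<in> edges n. e \<subseteq> C} \<union> (\<lambda>c. {c, k}) ` C"
    then show "e \<in> {e \<in> edges n. e \<subseteq> insert k C}"
      using C k by (auto simp: doubleton_in_edges_iff)
  qed
  moreover have "(\<Sum>e\<in>{e \<in> edges n. e \<subseteq> C} \<union> (\<lambda>c. {c, k}) ` C. w (Edge e)) =
      (\<Sum>e | e \<in> edges n \<and> e \<subseteq> C. w (Edge e)) + (\<Sum>e\<in>(\<lambda>c. {c, k}) ` C. w (Edge e))"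
    using fin k(2) by (intro sum.union_disjoint) auto
  moreover have "(\<Sum>e\<in>(\<lambda>c. {c, k}) ` C. w (Edge e)) = (\<Sum>c\<in>C. w (Edge {c, k}))"
    using k(2) by (subst sum.reindex) (auto simp: inj_on_def doubleton_eq_iff)
  ultimately show ?thesis
    by (simp add: cluster_weight_def Min)
qed

lemma cluster_weight_singleton:
  "cluster_weight w n {u} = (if 4 \<le> u then w (Rep u) else 0)"
proof -
  have "{e \<in> edges n. e \<subseteq> {u}} = {}"
    by (auto simp: edges_def)
  then show ?thesis
    by (simp add: cluster_weight_def del: Collect_empty_eq)
qed

section \<open>Exchanging two clusters while the others stay fixed\<close>

text \<open>In the induction the new element becomes a cluster of its own beside
  \<open>k - 1\<close> clusters of the rest, except that for \<open>k = 1\<close> everything forms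
  one cluster.\<close>

lemma ex_partition_on_card:
  assumes "finite A" "0 < k" "k \<le> card A"
  shows "\<exists>\<rho>. partition_on A \<rho> \<and> card \<rho> = k"
  using assms
proof (induction A arbitrary: k rule: finite_induct)
  case empty
  then show ?case by simp
next
  case (insert x A)
  show ?case
  proof (cases "k = 1")
    case True
    have "partition_on (insert x A) {insert x A}"
      by (simp add: partition_on_space)
    with True show ?thesis
      by (intro exI [of _ "{insert x A}"]) auto
  next
    case False
    then have "0 < k - 1" "k - 1 \<le> card A"
      using insert by auto
    then obtain \<rho> where \<rho>: "partition_on A \<rho>" "card \<rho> = k - 1"
      using insert.IH by blast
    have "partition_on (insert x A) (insert {x} \<rho>)"
      using \<rho>(1) insert(2) by (auto simp: partition_on_def disjoint_def)
    moreover have "{x} \<notin> \<rho>"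
      using \<rho>(1) insert(2) by (auto simp: partition_on_def)
    moreover have "finite \<rho>"
      using insert(1) \<rho>(1) by (rule finite_elements)
    ultimately show ?thesis
      using \<rho>(2) insert.prems by (intro exI [of _ "insert {x} \<rho>"]) auto
  qed
qed

text \<open>Both pairs of clusters are completed by the same clusters outside \<open>T\<close>,
  whose weights cancel. The last assumption keeps \<open>v\<close> from representing any of the four
  clusters, so both partitions belong to the face.\<close>

lemma exchange_clusters:
  fixes w :: "coord \<Rightarrow> real"
  assumes const: "\<And>\<pi>. is_K_partition n K \<pi> \<Longrightarrow> v \<notin> Min ` \<pi> \<Longrightarrow> functional w n \<pi> = b"
    and K: "3 \<le> K" "K + 3 \<le> n"
    and T: "T \<subseteq> {1..n}" "card T \<le> 5" "v \<in> T"
    and CD: "C \<union> D = T" "C \<inter> D = {}" "C \<noteq> {}" "D \<noteq> {}"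
    and CD': "C' \<union> D' = T" "C' \<inter> D' = {}" "C' \<noteq> {}" "D' \<noteq> {}"
    and v: "\<And>X. X \<in> {C, D, C', D'} \<Longrightarrow> v \<in> X \<Longrightarrow> \<exists>a\<in>X. a < v"
  shows "cluster_weight w n C + cluster_weight w n D = cluster_weight w n C' + cluster_weight w n D'"
proof -
  have "finite T"
    using T(1) by (rule finite_subset) simp
  then have "card ({1..n} - T) = n - card T"
    using T(1) by (simp add: card_Diff_subset)
  then have "K - 2 \<le> card ({1..n} - T)"
    using K T(2) by simp
  then obtain \<rho> where \<rho>: "partition_on ({1..n} - T) \<rho>" "card \<rho> = K - 2"
    using ex_partition_on_card [of "{1..n} - T" "K - 2"] K(1) by auto
  have fin: "finite \<rho>"
    using \<rho>(1) by (rule finite_elements [rotated]) simp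
  have *: "cluster_weight w n X + cluster_weight w n Y + (\<Sum>Z\<in>\<rho>. cluster_weight w n Z) = b"
    if XY: "X \<union> Y = T" "X \<inter> Y = {}" "X \<noteq> {}" "Y \<noteq> {}"
      "v \<in> X \<longrightarrow> (\<exists>a\<in>X. a < v)" "v \<in> Y \<longrightarrow> (\<exists>a\<in>Y. a < v)" for X Y
  proof -
    have notin: "X \<notin> \<rho>" "Y \<notin> \<rho>" "X \<noteq> Y"
      using XY \<rho>(1) by (auto simp: partition_on_def)
    have part: "partition_on {1..n} (insert X (insert Y \<rho>))"
    proof (rule partition_onI)
      show "\<Union> (insert X (insert Y \<rho>)) = {1..n}"
        using XY(1) T(1) \<rho>(1) by (auto simp: partition_on_def)
      show "{} \<notin> insert X (insert Y \<rho>)"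
        using XY(3,4) \<rho>(1) by (auto simp: partition_on_def)
    next
      fix p q assume pq: "p \<in> insert X (insert Y \<rho>)" "q \<in> insert X (insert Y \<rho>)" "p \<noteq> q"
      have "X \<inter> Z = {}" "Y \<inter> Z = {}" "Z \<inter> X = {}" "Z \<inter> Y = {}" if "Z \<in> \<rho>" for Z
        using XY(1) \<rho>(1) that by (auto simp: partition_on_def)
      moreover have "Z \<inter> Z' = {}" if "Z \<in> \<rho>" "Z' \<in> \<rho>" "Z \<noteq> Z'" for Z Z'
        using \<rho>(1) that by (auto simp: partition_on_def disjoint_def)
      ultimately show "disjnt p q"
        unfolding disjnt_def using pq XY(2) by (elim insertE) (auto simp: Int_commute)
    qed
    then have KP: "is_K_partition n K (insert X (insert Y \<rho>))"
      using fin notin \<rho>(2) K(1) by (simp add: is_K_partition_def)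
    have "v \<noteq> Min Z" if "Z \<in> \<rho>" for Z
    proof -
      have "Min Z \<in> Z"
        using partition_on_Min_in(4) [OF part] that by simp
      with that \<rho>(1) have "Min Z \<notin> T"
        by (auto simp: partition_on_def)
      with T(3) show ?thesis by auto
    qed
    moreover have "v \<noteq> Min Z" if Z: "Z \<in> {X, Y}" for Z
    proof
      assume "v = Min Z"
      moreover have "finite Z" "Min Z \<in> Z"
        using partition_on_Min_in(1,4) [OF part] Z by auto
      ultimately obtain a where "a \<in> Z" "a < Min Z"
        using XY(5,6) Z by auto
      with \<open>finite Z\<close> show False
        by (meson Min_le not_le)
    qed
    ultimately have "v \<notin> Min ` (insert X (insert Y \<rho>))"
      by auto
    with KP have "functional w n (insert X (insert Y \<rho>)) = b"
      by (rule const)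
    then show ?thesis
      using fin notin by (simp add: functional_eq_sum_cluster_weight [OF part] add.assoc)
  qed
  have "cluster_weight w n C + cluster_weight w n D + (\<Sum>Z\<in>\<rho>. cluster_weight w n Z) = b"
    by (rule *) (use CD v in auto)
  moreover have "cluster_weight w n C' + cluster_weight w n D' + (\<Sum>Z\<in>\<rho>. cluster_weight w n Z) = b"
    by (rule *) (use CD' v in auto)
  ultimately show ?thesis by simp
qed

section \<open>Equations satisfied by the face\<close>

text \<open>The order of elimination matters. Once the edges at \<open>v\<close> have weight zero,
  \<open>v\<close> can accompany another vertex at no cost, which keeps it a non-representative
  while other vertices are moved.\<close>

lemma weights_vanish:
  fixes w :: "coord \<Rightarrow> real"
  assumes const: "\<And>\<pi>. is_K_partition n K \<pi> \<Longrightarrow> v \<notin> Min ` \<pi> \<Longrightarrow> functional w n \<pi> = b"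
    and K: "3 \<le> K" "K + 3 \<le> n"
    and v: "v \<in> {4..n}"
    and c: "c \<in> coords n" "c \<noteq> Rep v"
  shows "w c = 0"
proof -
  note ex = exchange_clusters [where w = w and v = v, OF const K]
  note ins = cluster_weight_insert [where n = n and w = w]
  have n: "6 \<le> n"
    using K by simp
  have card5: "card {a, b, c, d, e} \<le> 5" for a b c d e :: nat
    using card_length [of "[a, b, c, d, e]"] by simp
  have card4: "card {a, b, c, d} \<le> 5" for a b c d :: nat
    using card5 [of a b c d d] by (simp add: insert_commute)
  have card3: "card {a, b, c} \<le> 5" for a b c :: nat
    using card4 [of a b c c] by (simp add: insert_commute)
  \<comment> \<open>At least two of 1, 2, 3 differ from \<open>c\<close>. Both lie below every
    vertex from 4 on, so moving such a vertex between their clusters changes no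
    representative.\<close>
  have ex_ab: "\<exists>a b. a \<in> {1, 2, 3} \<and> b \<in> {1, 2, 3} \<and> a \<noteq> b \<and> a \<noteq> c \<and> b \<noteq> c" for c :: nat
  proof (cases "c \<in> {1, 2}")
    case True
    then show ?thesis
      by (intro exI [of _ "3 - c"] exI [of _ 3]) auto
  next
    case False
    then show ?thesis
      by (intro exI [of _ 1] exI [of _ 2]) auto
  qed
  have small_v: "w (Edge {a, v}) = w (Edge {b, v})" if "a \<in> {1, 2, 3}" "b \<in> {1, 2, 3}" "a \<noteq> b" for a b
  proof -
    have ab: "a < v" "b < v" "a \<in> {1..n}" "b \<in> {1..n}"
      using that v n by auto
    \<comment> \<open>Throughout, \<open>v\<close> sits in a cluster with some vertex of \<open>{1, 2, 3}\<close>: this keeps it from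
      being a representative.\<close>
    have "cluster_weight w n (insert v {a}) + cluster_weight w n {b} =
        cluster_weight w n {a} + cluster_weight w n (insert v {b})"
      by (rule ex [where T = "{a, b, v}"]) (use that ab v card3 in auto)
    then show ?thesis
      using ab v by (simp add: ins [of "{a}" a v] ins [of "{b}" b v])
  qed
  have edge_v: "w (Edge {c, v}) = 0" if c: "c \<in> {1..n}" "c \<noteq> v" for c
  proof -
    obtain a b where ab: "a \<in> {1, 2, 3}" "b \<in> {1, 2, 3}" "a \<noteq> b" "a \<noteq> c" "b \<noteq> c"
      using ex_ab by blast
    then have ab': "a < v" "b < v" "a \<in> {1..n}" "b \<in> {1..n}"
      using v n by auto
    \<comment> \<open>Moving \<open>v\<close> from the cluster of \<open>a\<close> and
      \<open>c\<close> to that of \<open>b\<close> equates the weights of two edges with that of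
      one; by \<open>small_v\<close> the edges to \<open>a\<close> and \<open>b\<close>
      cancel.\<close>
    have "cluster_weight w n (insert v {a, c}) + cluster_weight w n {b} =
        cluster_weight w n {a, c} + cluster_weight w n (insert v {b})"
      by (rule ex [where T = "{a, b, c, v}"]) (use c ab ab' v card4 in auto)
    then show ?thesis
      using ab ab' v c small_v [of a b] by (simp add: ins [of "{a, c}" a v] ins [of "{b}" b v])
  qed
  have v_edge: "w (Edge {v, c}) = 0" if "c \<in> {1..n}" "c \<noteq> v" for c
    using edge_v [OF that] by (simp add: insert_commute)
  have small_k: "w (Edge {a, k}) = w (Edge {b, k})"
    if "a \<in> {1, 2, 3}" "b \<in> {1, 2, 3}" "a \<noteq> b" and k: "k \<in> {4..n}" "k \<noteq> v" for a b k
  proof -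
    have ab: "a < v" "b < v" "a < k" "b < k" "a \<in> {1..n}" "b \<in> {1..n}" "k \<in> {1..n}"
      using that v n by auto
    have "cluster_weight w n (insert k {a, v}) + cluster_weight w n {b} =
        cluster_weight w n {a, v} + cluster_weight w n (insert k {b})"
      by (rule ex [where T = "{a, b, k, v}"]) (use that ab v card4 in auto)
    then show ?thesis
      using ab v k v_edge [of k] by (simp add: ins [of "{a, v}" a k] ins [of "{b}" b k])
  qed
  have edge_k: "w (Edge {c, k}) = 0" if k: "k \<in> {4..n}" and c: "c \<in> {1..n}" "c \<noteq> k" for c k
  proof (cases "k = v \<or> c = v")
    case True
    then show ?thesis
      using edge_v [of c] edge_v [of k] that by (auto simp: insert_commute)
  next
    case False
    obtain a b where ab: "a \<in> {1, 2, 3}" "b \<in> {1, 2, 3}" "a \<noteq> b" "a \<noteq> c" "b \<noteq> c"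
      using ex_ab by blast
    then have ab': "a < v" "b < v" "a < k" "b < k" "a \<in> {1..n}" "b \<in> {1..n}" "k \<in> {1..n}"
      using v n k by auto
    \<comment> \<open>The same move with \<open>k\<close> in place of \<open>v\<close>, while
      \<open>v\<close> stays with \<open>a\<close>. This exchange involves five vertices, the most
      that \<open>exchange_clusters\<close> admits.\<close>
    have "cluster_weight w n (insert k {a, c, v}) + cluster_weight w n {b} =
        cluster_weight w n {a, c, v} + cluster_weight w n (insert k {b})"
      by (rule ex [where T = "{a, b, c, k, v}"]) (use c ab ab' v False card5 in auto)
    then show ?thesis
      using ab ab' v c False small_k [of a b k] k v_edge [of k]
      by (simp add: ins [of "{a, c, v}" a k] ins [of "{b}" b k])
  qed
  have singles: "cluster_weight w n {1} = 0" "cluster_weight w n {2} = 0" "cluster_weight w n {3} = 0"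
    by (simp_all add: cluster_weight_singleton)
  have pair: "w (Edge {i, j}) + w (Rep u) = 0"
    if u: "u \<in> {4..n}" "u \<noteq> v" and ij: "i \<in> {1, 2, 3}" "j \<in> {1, 2, 3}" "i < j" for i j u
  proof -
    have ij': "i < v" "j < v" "i < u" "j < u" "i \<in> {1..n}" "j \<in> {1..n}" "u \<in> {1..n}" "v \<in> {1..n}"
      using ij u v n by auto
    \<comment> \<open>When \<open>j\<close> leaves \<open>i\<close> and joins \<open>u\<close>, the
      edge between \<open>i\<close> and \<open>j\<close> is lost and \<open>u\<close> ceases to be a
      representative; the remaining edges involved have weight zero.\<close>
    have "cluster_weight w n (insert j {i, v}) + cluster_weight w n {u} =
        cluster_weight w n {i, v} + cluster_weight w n (insert u {j})"
      by (rule ex [where T = "{i, j, u, v}"]) (use u ij ij' v card4 in auto)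
    moreover have "cluster_weight w n {u} = w (Rep u)" "cluster_weight w n {j} = 0"
      using u ij(2) by (auto simp: cluster_weight_singleton)
    ultimately show ?thesis
      using ij(3) ij' u edge_k [of u j] v_edge [of j]
      by (simp add: ins [of "{i, v}" i j] ins [of "{j}" j u])
  qed
  have Rep_u: "w (Rep u) = 0" if u: "u \<in> {4..n}" "u \<noteq> v" for u
  proof -
    \<comment> \<open>Here 3 leaves both 1 and 2. By \<open>pair\<close> each of the two lost edges
      has weight \<open>- w (Rep u)\<close>, so the relation reads
      \<open>- 2 * w (Rep u) + w (Rep u) = 0\<close>.\<close>
    have "cluster_weight w n (insert 3 {1, 2, v}) + cluster_weight w n {u} =
        cluster_weight w n {1, 2, v} + cluster_weight w n (insert u {3})"
      by (rule ex [where T = "{1, 2, 3, u, v}"]) (use u v card5 in auto)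
    moreover have "cluster_weight w n {u} = w (Rep u)"
      using u by (auto simp: cluster_weight_singleton)
    ultimately have "w (Edge {1, 3}) + w (Edge {2, 3}) + w (Rep u) = 0"
      using v u edge_k [of u 3] v_edge [of 3] singles
      by (auto simp: ins [of "{Suc 0, 2, v}" "Suc 0" 3] ins [of "{3}" 3 u])
    with pair [OF u, of 1 3] pair [OF u, of 2 3] show ?thesis by simp
  qed
  \<comment> \<open>The edges inside \<open>{1, 2, 3}\<close> are reached through
    \<open>pair\<close>, which calls for a second vertex from 4 on.\<close>
  obtain u where u: "u \<in> {4..n}" "u \<noteq> v"
  proof (cases "v = 4")
    case True
    with n that [of 5] show ?thesis by simp
  next
    case False
    with n that [of 4] show ?thesis by simp
  qed
  show ?thesis
  proof (cases c)
    case (Rep u)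
    with c Rep_u show ?thesis by (auto simp: coords_def)
  next
    case (Edge e)
    with c(1) obtain i j where e: "e = {i, j}" "i < j" "i \<in> {1..n}" "j \<in> {1..n}"
      by (auto simp: coords_def edges_def) (metis insert_commute linorder_neqE_nat)
    show ?thesis
    proof (cases "j \<in> {4..n}")
      case True
      with e edge_k [of j i] Edge show ?thesis by simp
    next
      case False
      with e have "i \<in> {1, 2, 3}" "j \<in> {1, 2, 3}" by auto
      with pair [OF u _ _ e(2)] Rep_u [OF u] Edge e(1) show ?thesis by simp
    qed
  qed
qed

text \<open>Partition the other vertices and add \<open>v\<close> to the cluster of 1. This supplies
  a vertex of the polytope on the face.\<close>

lemma ex_is_K_partition_nonrep:
  assumes K: "1 \<le> K" "K < n" and v: "v \<in> {2..n}"
  shows "\<exists>\<pi>. is_K_partition n K \<pi> \<and> v \<notin> Min ` \<pi>"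
proof -
  have "K \<le> card ({1..n} - {v})"
    using K v by simp
  then obtain \<rho> where \<rho>: "partition_on ({1..n} - {v}) \<rho>" "card \<rho> = K"
    using ex_partition_on_card [of "{1..n} - {v}" K] K by auto
  have "1 \<in> \<Union> \<rho>"
    using \<rho>(1) K v by (auto simp: partition_on_def)
  then obtain C where C: "C \<in> \<rho>" "1 \<in> C" by blast
  have fin: "finite \<rho>"
    using \<rho>(1) by (rule finite_elements [rotated]) simp
  define \<pi> where "\<pi> = insert (insert v C) (\<rho> - {C})"
  have v_notin: "v \<notin> D" if "D \<in> \<rho>" for D
    using \<rho>(1) that by (auto simp: partition_on_def)
  have part: "partition_on {1..n} \<pi>"
  proof (rule partition_onI)
    have "\<Union> \<pi> = insert v (\<Union> \<rho>)"
      using C(1) by (auto simp: \<pi>_def)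
    then show "\<Union> \<pi> = {1..n}"
      using \<rho>(1) v by (auto simp: partition_on_def)
    show "{} \<notin> \<pi>"
      using \<rho>(1) by (auto simp: partition_on_def \<pi>_def)
    have "D \<inter> E = {}" if "D \<in> \<rho>" "E \<in> \<rho>" "D \<noteq> E" for D E
      using \<rho>(1) that by (auto simp: partition_on_def disjoint_def)
    then show "disjnt p q" if "p \<in> \<pi>" "q \<in> \<pi>" "p \<noteq> q" for p q
      using that C(1) v_notin by (auto simp: \<pi>_def disjnt_def)
  qed
  moreover have "card \<pi> = K"
  proof -
    have "card \<pi> = Suc (card (\<rho> - {C}))"
      unfolding \<pi>_def using fin v_notin [of "insert v C"] by (subst card_insert_disjoint) auto
    also have "\<dots> = card \<rho>"
      using fin C(1) by (rule card_Suc_Diff1)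
    finally show ?thesis
      using \<rho>(2) by simp
  qed
  moreover have "v \<noteq> Min D" if "D \<in> \<pi>" for D
  proof (cases "D = insert v C")
    case True
    have "finite (insert v C)"
      using partition_on_Min_in(1) [OF part that] True by simp
    then have "Min D \<le> 1"
      using True C(2) by (intro Min_le) auto
    with v show ?thesis by auto
  next
    case False
    with that have "D \<in> \<rho>" by (auto simp: \<pi>_def)
    with v_notin partition_on_Min_in(4) [OF part that] show ?thesis by metis
  qed
  ultimately show ?thesis
    unfolding is_K_partition_def by blast
qed

section \<open>Counting edges inside clusters\<close>

text \<open>An endpoint outside \<open>X\<close> is either \<open>z\<close> or the representative of
  its cluster. An edge has two distinct endpoints, so the only candidate joins \<open>z\<close> to
  its representative.\<close>

lemma ex1_edge_in_cluster_if_sole_nonrep: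
  assumes \<pi>: "partition_on {1..n} \<pi>"
    and X: "X \<inter> Min ` \<pi> = {}"
    and z: "{1..n} - Min ` \<pi> - X = {z}"
  shows "\<exists>e. {e \<in> edges n. (\<exists>C\<in>\<pi>. e \<subseteq> C) \<and> e \<inter> X = {}} = {e}"
proof -
  have "z \<in> \<Union> \<pi>"
    using z \<pi> by (auto simp: partition_on_def)
  then obtain C where C: "C \<in> \<pi>" "z \<in> C" by blast
  note MinC = partition_on_Min_in [OF \<pi> C(1)]
  have z': "z \<in> {1..n}" "z \<notin> X" "z \<notin> Min ` \<pi>"
    using z by blast+
  have "{e \<in> edges n. (\<exists>C\<in>\<pi>. e \<subseteq> C) \<and> e \<inter> X = {}} = {{Min C, z}}"
  proof (intro equalityI subsetI)
    fix e assume "e \<in> {e \<in> edges n. (\<exists>C\<in>\<pi>. e \<subseteq> C) \<and> e \<inter> X = {}}"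
    then obtain i j D where e: "e = {i, j}" "i \<in> {1..n}" "j \<in> {1..n}" "i \<noteq> j"
      and D: "D \<in> \<pi>" "i \<in> D" "j \<in> D" and eX: "i \<notin> X" "j \<notin> X"
      by (auto simp: edges_def)
    have rep: "k = z \<or> k = Min D" if "k \<in> D" "k \<in> {1..n}" "k \<notin> X" for k
    proof (rule disjCI)
      assume "k \<noteq> Min D"
      have "k \<notin> Min ` \<pi>"
      proof
        assume "k \<in> Min ` \<pi>"
        with \<open>k \<in> D\<close> D(1) have "k = Min D"
          by (intro rep_of_own_cluster [OF \<pi>])
        with \<open>k \<noteq> Min D\<close> show False ..
      qed
      with that z show "k = z" by blast
    qed
    have "z \<in> D" "e = {Min D, z}"
      using rep [of i] rep [of j] e D eX by auto
    moreover have "D = C"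
      using \<open>z \<in> D\<close> C D(1) \<pi> by (auto simp: partition_on_def disjoint_def)
    ultimately show "e \<in> {{Min C, z}}" by simp
  next
    fix e assume e: "e \<in> {{Min C, z}}"
    have "Min C \<noteq> z" "Min C \<notin> X"
      using C(1) z' X by auto
    then have "e \<in> edges n" "e \<subseteq> C" "e \<inter> X = {}"
      using e MinC C(2) z' by (auto simp: doubleton_in_edges_iff)
    with C(1) show "e \<in> {e \<in> edges n. (\<exists>C\<in>\<pi>. e \<subseteq> C) \<and> e \<inter> X = {}}" by blast
  qed
  then show ?thesis by blast
qed

lemma functional_edge_count:
  assumes "\<And>u. w (Rep u) = 0" and "\<And>e. w (Edge e) = of_bool (e \<inter> X = {})"
  shows "functional w n \<pi> = card {e \<in> edges n. (\<exists>C\<in>\<pi>. e \<subseteq> C) \<and> e \<inter> X = {}}"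
proof -
  have "functional w n \<pi> = (\<Sum>e\<in>edges n. if (\<exists>C\<in>\<pi>. e \<subseteq> C) \<and> e \<inter> X = {} then 1 else 0)"
    unfolding functional_def assms char_entry.simps
    by (simp only: mult_zero_left sum.neutral_const add_0_left) (rule sum.cong, auto)
  also have "\<dots> = (\<Sum>e | e \<in> edges n \<and> (\<exists>C\<in>\<pi>. e \<subseteq> C) \<and> e \<inter> X = {}. 1)"
    by (rule sum.inter_filter [symmetric]) simp
  also have "\<dots> = card {e \<in> edges n. (\<exists>C\<in>\<pi>. e \<subseteq> C) \<and> e \<inter> X = {}}"
    by simp
  finally show ?thesis .
qed

text \<open>Of the \<open>n - K\<close> non-representatives all but one lie in \<open>X\<close>. The
  choice \<open>X = {}\<close> excludes \<open>K = n - 1\<close>, and \<open>X = {v}\<close> gives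
  the extra equation of the face for \<open>K = n - 2\<close>.\<close>

lemma functional_edge_count_eq_1:
  assumes "is_K_partition n K \<pi>" "X \<subseteq> {1..n}" "X \<inter> Min ` \<pi> = {}" "n = K + card X + 1"
    and "\<And>u. w (Rep u) = 0" and "\<And>e. w (Edge e) = of_bool (e \<inter> X = {})"
  shows "functional w n \<pi> = 1"
proof -
  note card = card_Min_image [OF assms(1)]
  have "finite X"
    using assms(2) by (rule finite_subset) simp
  then have "card ({1..n} - Min ` \<pi> - X) = n - K - card X"
    using assms(2,3) card by (subst card_Diff_subset) (auto simp: card_Diff_subset)
  then have "card ({1..n} - Min ` \<pi> - X) = 1"
    using assms(4) by simp
  then obtain z where "{1..n} - Min ` \<pi> - X = {z}"
    by (metis card_1_singletonE)
  then obtain e where "{e \<in> edges n. (\<exists>C\<in>\<pi>. e \<subseteq> C) \<and> e \<inter> X = {}} = {e}"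
    using ex1_edge_in_cluster_if_sole_nonrep assms(1,3) unfolding is_K_partition_def by meson
  then show ?thesis
    by (simp add: functional_edge_count [where X = X, OF assms(5,6)])
qed

section \<open>Values of \<open>K\<close> excluded by full-dimensionality\<close>

lemma one_is_rep:
  fixes n :: nat
  assumes "partition_on {1..n} \<pi>" "1 \<le> n"
  shows "1 \<in> Min ` \<pi>"
proof (rule ccontr)
  assume "1 \<notin> Min ` \<pi>"
  moreover have "1 \<in> {1..n}"
    using assms(2) by simp
  ultimately obtain k where "k \<in> Min ` \<pi>" "k < 1"
    by (metis smaller_rep_if_nonrep [OF assms(1)])
  then show False
    using partition_on_Min_in(5) [OF assms(1)] by fastforce
qed

text \<open>Let \<open>r\<close> be the representative other than 1. If \<open>r = 2\<close>, vertex
  3 joins exactly one of 1 and 2; if \<open>r = 3\<close>, only 1 and 2 are together; if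
  \<open>r \<ge> 4\<close>, all three are together and both sides equal 3.\<close>

lemma triangle_equation_2_partition:
  assumes \<pi>: "is_K_partition n 2 \<pi>" and n: "3 \<le> n"
  shows "char_entry \<pi> (Edge {1, 2}) + char_entry \<pi> (Edge {1, 3}) + char_entry \<pi> (Edge {2, 3}) =
    1 + 2 * (\<Sum>u\<in>{4..n}. char_entry \<pi> (Rep u))"
proof -
  have part: "partition_on {1..n} \<pi>"
    using \<pi> by (simp add: is_K_partition_def)
  define s where "s i j \<longleftrightarrow> (\<exists>C\<in>\<pi>. {i, j} \<subseteq> C)" for i j
  have s_trans: "s i k" if ijk: "s i j" "s j k" for i j k
  proof -
    obtain C D where CD: "C \<in> \<pi>" "D \<in> \<pi>" "i \<in> C" "j \<in> C" "j \<in> D" "k \<in> D"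
      using ijk unfolding s_def by blast
    then have "C = D"
      using part unfolding partition_on_def disjoint_def by blast
    with CD show ?thesis
      by (auto simp: s_def)
  qed
  have s_sym: "s i j" if "s j i" for i j
    using that by (auto simp: s_def)
  have s_reps: "\<not> s i j" if "i \<in> Min ` \<pi>" "j \<in> Min ` \<pi>" "i \<noteq> j" for i j
    using that rep_of_own_cluster [OF part] unfolding s_def by (metis insert_subset)
  have nonrep: "\<exists>k\<in>Min ` \<pi>. k < i \<and> s k i" if "i \<in> {1..n}" "i \<notin> Min ` \<pi>" for i
    using smaller_rep_if_nonrep [OF part that] unfolding s_def by metis
  have rep1: "1 \<in> Min ` \<pi>"
    using one_is_rep [OF part] n by simp
  have rep0: "0 \<notin> Min ` \<pi>"
    using card_Min_image(2) [OF \<pi>] by auto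
  obtain x y where xy: "Min ` \<pi> = {x, y}" "x \<noteq> y"
    using card_Min_image(1) [OF \<pi>] unfolding card_2_iff by blast
  define r where "r = (if x = 1 then y else x)"
  have M: "Min ` \<pi> = {1, r}" "r \<noteq> 1"
    unfolding xy(1) r_def using rep1 [unfolded xy(1)] xy(2) by auto
  have r: "r \<in> {1..n}"
    using card_Min_image(2) [OF \<pi>] M(1) by auto
  have "(\<Sum>u\<in>{4..n}. char_entry \<pi> (Rep u)) = (\<Sum>u\<in>{4..n}. if u = r then 1 else 0)"
    unfolding char_entry_Rep_iff [OF part] M(1) by (intro sum.cong) auto
  then have sum: "(\<Sum>u\<in>{4..n}. char_entry \<pi> (Rep u)) = of_bool (4 \<le> r)"
    using r by simp
  have edge: "char_entry \<pi> (Edge {i, j}) = of_bool (s i j)" for i j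
    by (simp add: s_def)
  have below3: "k = 1 \<or> k = 2" if "k < 3" "k \<in> Min ` \<pi>" for k
    using that rep0 by (cases "k = 0") auto
  consider "r = 2" | "r = 3" | "4 \<le> r"
    using r M(2) by fastforce
  then show ?thesis
  proof cases
    case 1
    then have "\<not> s 1 2"
      using s_reps M by simp
    moreover have "s 1 3 \<or> s 2 3"
      using nonrep [of 3] below3 n M(1) 1 by auto
    ultimately have "s 1 3 \<longleftrightarrow> \<not> s 2 3"
      using s_trans s_sym by blast
    then show ?thesis
      using \<open>\<not> s 1 2\<close> 1 by (simp only: edge sum) auto
  next
    case 2
    have "s 1 2"
      using nonrep [of 2] n M(1) 2 by auto
    moreover have "\<not> s 1 3"
      using s_reps M 2 by simp
    moreover have "\<not> s 2 3"
      using calculation s_trans by blast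
    ultimately show ?thesis
      using 2 by (simp add: edge sum del: char_entry.simps)
  next
    case 3
    have "s 1 2"
      using nonrep [of 2] n M(1) 3 by auto
    moreover have "s 1 3"
      using nonrep [of 3] n M(1) 3 by auto
    moreover have "s 2 3"
      using calculation s_trans s_sym by blast
    ultimately show ?thesis
      using 3 by (simp add: edge sum del: char_entry.simps)
  qed
qed

text \<open>Each excluded \<open>K\<close> has an equation with nonzero coefficient at the edge
  \<open>{1, 2}\<close>: this entry is 0 for \<open>K = 0\<close> or \<open>K \<ge> n\<close> and 1
  for \<open>K = 1\<close>, the triangle equation holds for \<open>K = 2\<close>, and all edge
  entries sum to 1 for \<open>K = n - 1\<close>.\<close>

lemma full_dimensional_imp_bounds:
  fixes \<phi> :: "'d::finite \<Rightarrow> coord"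
  assumes \<phi>: "bij_betw \<phi> UNIV (coords n)" and n: "4 \<le> n"
    and full: "full_dimensional (partition_polytope \<phi> n K)"
  shows "3 \<le> K" "K + 2 \<le> n"
proof -
  have no_eq: False
    if "w (Edge {1, 2}) \<noteq> 0" "\<And>\<pi>. is_K_partition n K \<pi> \<Longrightarrow> functional w n \<pi> = b" for w b
  proof -
    have "Edge {1, 2} \<in> coords n"
      using n by (auto simp: coords_def doubleton_in_edges_iff)
    from not_full_dimensional_if_functional_const [OF \<phi> this that] full show False by blast
  qed
  have edge_only: "functional (\<lambda>c. of_bool (c \<in> Edge ` E)) n \<pi> = (\<Sum>e\<in>E. char_entry \<pi> (Edge e))"
    if "E \<subseteq> edges n" for E \<pi>
  proof -
    have "functional (\<lambda>c. of_bool (c \<in> Edge ` E)) n \<pi> =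
        (\<Sum>e\<in>edges n. if e \<in> E then char_entry \<pi> (Edge e) else 0)"
      unfolding functional_def
      by (subst sum.neutral) (auto intro!: sum.cong simp del: char_entry.simps sum_mult_of_bool_eq sum_of_bool_mult_eq)
    also have "\<dots> = (\<Sum>e\<in>E. char_entry \<pi> (Edge e))"
      using that by (subst sum.inter_restrict [symmetric]) (auto simp: Int_absorb1)
    finally show ?thesis .
  qed
  have e12: "{{1, 2}} \<subseteq> edges n"
    using n by (simp add: doubleton_in_edges_iff)
  have "K \<noteq> 0" "K \<noteq> 1" "K < n"
  proof -
    have "K = 1 \<or> (K \<noteq> 0 \<and> K < n)"
    proof (rule ccontr)
      assume "\<not> ?thesis"
      then have K: "K = 0 \<or> n \<le> K" by auto
      show False
      proof (rule no_eq [of "\<lambda>c. of_bool (c \<in> Edge ` {{1, 2}})" 0])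
        fix \<pi> assume \<pi>: "is_K_partition n K \<pi>"
        then have part: "partition_on {1..n} \<pi>"
          by (simp add: is_K_partition_def)
        have reps: "1 \<in> Min ` \<pi>"
          using one_is_rep [OF part] n by simp
        then have "K \<noteq> 0"
          using card_Min_image(1,3) [OF \<pi>] by (metis card_0_eq empty_iff finite_imageI)
        with K have "card {1..n} \<le> card (Min ` \<pi>)"
          using card_Min_image(1) [OF \<pi>] by simp
        then have "Min ` \<pi> = {1..n}"
          by (intro card_seteq card_Min_image(2) [OF \<pi>]) simp_all
        then have "2 \<in> Min ` \<pi>"
          using n by simp
        have "\<not> {1, 2} \<subseteq> C" if "C \<in> \<pi>" for C
        proof
          assume "{1, 2} \<subseteq> C"
          then have "1 = Min C" "2 = Min C"
            using rep_of_own_cluster [OF part reps _ that]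
              rep_of_own_cluster [OF part \<open>2 \<in> Min ` \<pi>\<close> _ that] by simp_all
          then show False by simp
        qed
        then show "functional (\<lambda>c. of_bool (c \<in> Edge ` {{1, 2}})) n \<pi> = 0"
          by (subst edge_only [OF e12]) auto
      qed auto
    qed
    moreover have "K \<noteq> 1"
    proof
      assume "K = 1"
      show False
      proof (rule no_eq [of "\<lambda>c. of_bool (c \<in> Edge ` {{1, 2}})" 1])
        fix \<pi> assume \<pi>: "is_K_partition n K \<pi>"
        with \<open>K = 1\<close> obtain C where "\<pi> = {C}"
          by (auto simp: is_K_partition_def card_1_singleton_iff)
        with \<pi> have "\<pi> = {{1..n}}"
          by (auto simp: is_K_partition_def partition_on_def)
        then show "functional (\<lambda>c. of_bool (c \<in> Edge ` {{1, 2}})) n \<pi> = 1"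
          using n by (subst edge_only [OF e12]) auto
      qed auto
    qed
    ultimately show "K \<noteq> 0" "K \<noteq> 1" "K < n" by auto
  qed
  moreover have "K \<noteq> 2"
  proof
    assume K: "K = 2"
    define E where "E = {{1, 2}, {1, 3}, {2, 3 :: nat}}"
    \<comment> \<open>The coefficient -2 brings the representative sum of the triangle equation to
      the left-hand side.\<close>
    define w where "w c = (case c of Rep u \<Rightarrow> (- 2 :: real) | Edge e \<Rightarrow> of_bool (e \<in> E))" for c
    show False
    proof (rule no_eq [of w 1])
      fix \<pi> assume \<pi>: "is_K_partition n K \<pi>"
      have E: "E \<subseteq> edges n"
        using n by (auto simp: E_def doubleton_in_edges_iff)
      have "functional w n \<pi> =
          - 2 * (\<Sum>u\<in>{4..n}. char_entry \<pi> (Rep u)) + functional (\<lambda>c. of_bool (c \<in> Edge ` E)) n \<pi>"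
        by (simp add: functional_def w_def sum_distrib_left sum_negf image_iff del: char_entry.simps)
      also have "\<dots> = - 2 * (\<Sum>u\<in>{4..n}. char_entry \<pi> (Rep u)) +
          (char_entry \<pi> (Edge {1, 2}) + char_entry \<pi> (Edge {1, 3}) + char_entry \<pi> (Edge {2, 3}))"
        unfolding edge_only [OF E] by (simp add: E_def doubleton_eq_iff)
      also have "\<dots> = 1"
        using \<pi> n K by (subst triangle_equation_2_partition [where n = n]) auto
      finally show "functional w n \<pi> = 1" .
    qed (simp add: w_def E_def)
  qed
  moreover have "K + 1 \<noteq> n"
  proof
    assume K: "K + 1 = n"
    define w where "w c = (case c of Rep u \<Rightarrow> (0 :: real) | Edge e \<Rightarrow> 1)" for c
    show False
    proof (rule no_eq [of w 1])
      fix \<pi> assume "is_K_partition n K \<pi>"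
      then show "functional w n \<pi> = 1"
        by (rule functional_edge_count_eq_1 [where X = "{}"]) (use K in \<open>auto simp: w_def\<close>)
    qed (simp add: w_def)
  qed
  ultimately show "3 \<le> K" "K + 2 \<le> n" by auto
qed

section \<open>Dimension of the face\<close>

theorem theorem4p2:
  fixes n K v :: nat and \<phi> :: "'d::finite \<Rightarrow> coord"
  assumes "bij_betw \<phi> UNIV (coords n)"
    and "full_dimensional (partition_polytope \<phi> n K)"
    and "v \<in> {4..n}"
  shows "facet_defining (partition_polytope \<phi> n K) (\<lambda>x. x $ inv \<phi> (Rep v)) 0 \<longleftrightarrow> K \<noteq> n - 2"
proof -
  let ?P = "partition_polytope \<phi> n K"
  define i where "i = inv \<phi> (Rep v)"
  define F where "F = {x \<in> ?P. x $ i = 0}"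
  have n: "4 \<le> n"
    using assms(3) by simp
  note bounds = full_dimensional_imp_bounds [OF assms(1) n assms(2)]
  have "Rep v \<in> range \<phi>"
    using assms(1,3) by (auto simp: bij_betw_def coords_def)
  then have \<phi>i: "\<phi> i = Rep v"
    unfolding i_def by (rule f_inv_into_f)
  have "inj \<phi>"
    using assms(1) by (rule bij_betw_imp_inj_on)
  have char_vec_i: "char_vec \<phi> \<pi> $ i = of_bool (v \<in> Min ` \<pi>)" if "is_K_partition n K \<pi>" for \<pi>
    using that char_entry_Rep_iff [of n \<pi> v] by (simp add: char_vec_def \<phi>i is_K_partition_def)
  have char_vec_in_P: "char_vec \<phi> \<pi> \<in> ?P" if "is_K_partition n K \<pi>" for \<pi>
    unfolding partition_polytope_def using that by (intro hull_inc) auto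
  have valid: "0 \<le> x $ i" if "x \<in> ?P" for x
  proof -
    have "?P \<subseteq> {x. axis i 1 \<bullet> x \<ge> 0}"
      unfolding partition_polytope_def
      by (intro hull_minimal convex_halfspace_ge) (use char_vec_i in \<open>auto simp: inner_axis'\<close>)
    with that show ?thesis by (auto simp: inner_axis')
  qed
  have "linear (\<lambda>x :: real ^ 'd. x $ i)"
    by (rule linearI) auto
  with valid assms(2) have facet_iff: "facet_defining ?P (\<lambda>x. x $ i) 0 \<longleftrightarrow> aff_dim F + 1 = int DIM(real ^ 'd)"
    by (auto simp: facet_defining_def full_dimensional_def F_def)
  have "F \<subseteq> {x. axis i 1 \<bullet> x = 0}"
    by (auto simp: F_def inner_axis')
  then have hull_F: "affine hull F \<subseteq> {x. axis i 1 \<bullet> x = 0}"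
    by (intro hull_minimal affine_hyperplane)
  have "\<not> facet_defining ?P (\<lambda>x. x $ i) 0" if K: "K = n - 2"
  proof
    assume "facet_defining ?P (\<lambda>x. x $ i) 0"
    then have dim_F: "aff_dim F + 1 = int DIM(real ^ 'd)"
      using facet_iff by blast
    define w where "w c = (case c of Rep u \<Rightarrow> (0 :: real) | Edge e \<Rightarrow> of_bool (e \<inter> {v} = {}))" for c
    define a where "a = (\<chi> d. w (\<phi> d))"
    \<comment> \<open>When \<open>v\<close> is a representative, the edge count lies between 0 and
      \<open>card (edges n)\<close>, so \<open>B\<close> bounds its distance from 1.\<close>
    define B where "B = real (card (edges n)) + 1"
    have a_char_vec: "a \<bullet> char_vec \<phi> \<pi> = functional w n \<pi>" for \<pi>
      unfolding a_def by (rule inner_char_vec [OF assms(1)])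
    \<comment> \<open>With slack \<open>B x\<^sub>v\<close> the equation of the face becomes two inequalities valid for all vertices of
      the polytope, hence for their convex hull.\<close>
    have "\<bar>a \<bullet> char_vec \<phi> \<pi> - 1\<bar> \<le> B * char_vec \<phi> \<pi> $ i" if \<pi>: "is_K_partition n K \<pi>" for \<pi>
    proof (cases "v \<in> Min ` \<pi>")
      case True
      have "functional w n \<pi> = card {e \<in> edges n. (\<exists>C\<in>\<pi>. e \<subseteq> C) \<and> e \<inter> {v} = {}}"
        by (rule functional_edge_count) (simp_all add: w_def)
      moreover have "card {e \<in> edges n. (\<exists>C\<in>\<pi>. e \<subseteq> C) \<and> e \<inter> {v} = {}} \<le> card (edges n)"
        by (rule card_mono) auto
      ultimately show ?thesis
        using True char_vec_i [OF \<pi>] by (simp add: a_char_vec B_def)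
    next
      case False
      have "functional w n \<pi> = 1"
        by (rule functional_edge_count_eq_1 [OF \<pi>, where X = "{v}"])
          (use False K n assms(3) in \<open>auto simp: w_def\<close>)
      with False char_vec_i [OF \<pi>] show ?thesis by (simp add: a_char_vec)
    qed
    then have "?P \<subseteq> {x. (a - B *\<^sub>R axis i 1) \<bullet> x \<le> 1} \<inter> {x. (a + B *\<^sub>R axis i 1) \<bullet> x \<ge> 1}"
      unfolding partition_polytope_def
      by (intro hull_minimal convex_Int convex_halfspace_le convex_halfspace_ge)
        (fastforce simp: inner_diff_left inner_add_left inner_axis' abs_le_iff)
    then have "F \<subseteq> {x. a \<bullet> x = 1}"
      by (force simp: F_def inner_diff_left inner_add_left inner_axis')
    then have "affine hull F \<subseteq> {x. a \<bullet> x = 1}"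
      by (intro hull_minimal affine_hyperplane)
    \<comment> \<open>If \<open>F\<close> were a facet, adjoining the origin would raise its
      dimension to that of the whole space, although the origin also satisfies
      \<open>x $ i = 0\<close>.\<close>
    then have "0 \<notin> affine hull F"
      by auto
    then have "affine hull (insert 0 F) = UNIV"
      using dim_F by (simp only: aff_dim_eq_full [symmetric] aff_dim_insert if_False)
    moreover have "affine hull (insert 0 F) \<subseteq> {x. axis i 1 \<bullet> x = 0}"
      using \<open>F \<subseteq> {x. axis i 1 \<bullet> x = 0}\<close> by (intro hull_minimal affine_hyperplane) auto
    ultimately have "axis i 1 \<bullet> (axis i 1 :: real ^ 'd) = 0"
      by blast
    then show False by simp
  qed
  moreover have "facet_defining ?P (\<lambda>x. x $ i) 0" if "K \<noteq> n - 2"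
  proof -
    have K: "3 \<le> K" "K + 3 \<le> n"
      using bounds that by auto
    \<comment> \<open>The unit vector lies off the hyperplane containing \<open>F\<close>, so
      adjoining it adds exactly one dimension. It remains to see that the enlarged set lies in no
      hyperplane.\<close>
    have "(axis i 1 :: real ^ 'd) \<notin> affine hull F"
      using hull_F by (auto simp: inner_axis')
    then have insert_F: "aff_dim (insert (axis i 1) F) = aff_dim F + 1"
      by (simp add: aff_dim_insert)
    have "\<not> aff_dim (insert (axis i 1) F) < int DIM(real ^ 'd)"
    proof
      assume "aff_dim (insert (axis i 1) F) < int DIM(real ^ 'd)"
      then obtain a b where a: "a \<noteq> 0" "insert (axis i 1) F \<subseteq> {x. a \<bullet> x = b}"
        by (rule aff_lowdim_subset_hyperplane)
      define w where "w c = a $ inv \<phi> c" for c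
      have w: "a = (\<chi> d. w (\<phi> d))"
        using \<open>inj \<phi>\<close> by (simp add: vec_eq_iff w_def)
      have const: "functional w n \<pi> = b" if "is_K_partition n K \<pi>" "v \<notin> Min ` \<pi>" for \<pi>
      proof -
        have "char_vec \<phi> \<pi> \<in> F"
          using that char_vec_i char_vec_in_P by (simp add: F_def)
        with a(2) have "a \<bullet> char_vec \<phi> \<pi> = b" by auto
        then show ?thesis
          unfolding w inner_char_vec [OF assms(1)] .
      qed
      have a_zero: "a $ d = 0" if "d \<noteq> i" for d
      proof -
        have "\<phi> d \<in> coords n"
          using assms(1) by (auto simp: bij_betw_def)
        moreover have "\<phi> d \<noteq> Rep v"
          using \<phi>i \<open>inj \<phi>\<close> that by (metis injD)
        ultimately have "w (\<phi> d) = 0"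
          using weights_vanish [OF const K assms(3)] by blast
        then show ?thesis
          by (subst w) simp
      qed
      then have a_axis: "a = a $ i *\<^sub>R axis i 1"
        by (auto simp: vec_eq_iff axis_def)
      \<comment> \<open>Only the coefficient at \<open>i\<close> is left. A point of the face gives
        \<open>b = 0\<close>, the unit vector gives \<open>a $ i = b\<close>, and together they
        contradict \<open>a \<noteq> 0\<close>.\<close>
      obtain \<pi> where "is_K_partition n K \<pi>" "v \<notin> Min ` \<pi>"
        using ex_is_K_partition_nonrep [of K n v] K assms(3) by auto
      then have "char_vec \<phi> \<pi> \<in> F"
        using char_vec_i char_vec_in_P by (simp add: F_def)
      with a(2) have "a \<bullet> char_vec \<phi> \<pi> = b" "char_vec \<phi> \<pi> $ i = 0"
        by (auto simp: F_def)
      then have "b = 0"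
        by (subst (asm) a_axis) (simp add: inner_axis')
      moreover have "a \<bullet> axis i 1 = b"
        using a(2) by auto
      ultimately have "a $ i = 0"
        by (simp add: inner_axis)
      with a_axis a(1) show False by simp
    qed
    with insert_F aff_dim_le_DIM [of "insert (axis i 1) F"] show ?thesis
      unfolding facet_iff by linarith
  qed
  ultimately show ?thesis
    unfolding i_def by blast
qed

end
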